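(* Let $K\in C^\infty(E_* )$ be an everywhere strictly positive function that depends only on the base point, i.e. $K=k\circ\pi$ on $E_*$ for some strictly positive $k\in C^\infty(M)$. Then there exists a radial graph $\mathcal Y=\{e^{u(\xi)}\xi:\xi\in\Sigma\}$, $u\in C^\infty(\Sigma)$, whose vertical mean curvature equals $K$, that is, $\mathcal M^v_{\mathcal Y}(\eta)=K(\eta)$ for every $\eta\in\mathcal Y$.
   Context: $(M,g)$ is a compact Riemannian manifold without boundary, of dimension $n\ge 1$; $(E,\tilde g)$ is a (smooth) Riemannian vector bundle over $M$ of rank $m\ge 2$, with projection $\pi:E\to M$ and fibres $E_x=\pi^{-1}(x)$. $E_*$ is $E$ minus the zero section, $\|\xi\|=\tilde g(\xi,\xi)^{1/2}$, and $\Sigma=\{\xi\in E:\|\xi\|=1\}$ is the unit sphere bundle. Radial graph: for $u\in C^\infty(\Sigma)$, the radial graph $\mathcal Y$ on $\Sigma$ defined by $u$ is the map $\Sigma\to E_*$, $\xi\mapsto e^{u(\xi)}\xi$, identified with its image. Vertical mean curvature: for $x\in M$ let $\mathcal Y_x=\mathcal Y\cap E_x$, a hypersurface of the Euclidean space $(E_x,\tilde g_x)$ of dimension $m$. For $\eta\in\mathcal Y_x$, the vertical mean curvature $\mathcal M^v_{\mathcal Y}(\eta)$ is the mean curvature of $\mathcal Y_x$ at $\eta$ as a hypersurface of $E_x$, i.e. the trace (sum of the principal curvatures, not normalized), with respect to the induced metric, of the second fundamental form $(X,Y)\mapsto \tilde g_x(\overline D_X\tilde\nu,Y)$, where $\tilde\nu$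 is the outward unit normal (positive inner product with the radial direction) and $\overline D$ is the flat connection of $E_x$. With this convention the sphere of radius $r$ in $E_x$ has mean curvature $(m-1)/r$. *)

theory Defs
  imports "HOL-Analysis.Analysis"
begin

section \<open>Smooth maps between Euclidean spaces\<close>

text \<open>Both predicates are meant for open \<open>S\<close>; there the continuity of all directional
  derivatives of order at most \<open>k\<close> is equivalent to being of class \<open>C\<^sup>k\<close>.\<close>

primrec Ck_on ::
  "nat \<Rightarrow> ('a::euclidean_space \<Rightarrow> 'b::real_normed_vector) \<Rightarrow> 'a set \<Rightarrow> bool" where
  "Ck_on 0 f S \<longleftrightarrow> continuous_on S f"
| "Ck_on (Suc k) f S \<longleftrightarrow>
     (\<forall>x\<in>S. f differentiable (at x)) \<and>
     (\<forall>v. Ck_on k (\<lambda>x. frechet_derivative f (at x) v) S)"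

definition smooth_on ::
  "('a::euclidean_space \<Rightarrow> 'b::real_normed_vector) \<Rightarrow> 'a set \<Rightarrow> bool" where
  "smooth_on f S \<longleftrightarrow> (\<forall>k. Ck_on k f S)"

section \<open>Smooth manifolds\<close>

text \<open>A chart \<open>(U, \<phi>)\<close> consists of its domain and its coordinate map; the values of \<open>\<phi>\<close>
  outside \<open>U\<close> are irrelevant. The model space is a Euclidean space \<open>'b\<close>, so the manifolds have
  dimension \<open>DIM('b)\<close>, which is at least 1, and no boundary.\<close>

type_synonym ('p, 'b) chart = "'p set \<times> ('p \<Rightarrow> 'b)"

definition is_chart :: "'p topology \<Rightarrow> ('p, 'b::euclidean_space) chart \<Rightarrow> bool" where
  "is_chart T c \<longleftrightarrow>
     openin T (fst c) \<and> open (snd c ` fst c) \<and>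
     homeomorphic_map (subtopology T (fst c)) (top_of_set (snd c ` fst c)) (snd c)"

definition chart_inv :: "('p, 'b) chart \<Rightarrow> 'b \<Rightarrow> 'p" where
  "chart_inv c = inv_into (fst c) (snd c)"

definition transition :: "('p, 'b) chart \<Rightarrow> ('p, 'b) chart \<Rightarrow> 'b \<Rightarrow> 'b" where
  "transition c d = snd d \<circ> chart_inv c"

definition smooth_compatible ::
  "('p, 'b::euclidean_space) chart \<Rightarrow> ('p, 'b) chart \<Rightarrow> bool" where
  "smooth_compatible c d \<longleftrightarrow>
     smooth_on (transition c d) (snd c ` (fst c \<inter> fst d)) \<and>
     smooth_on (transition d c) (snd d ` (fst c \<inter> fst d))"

record ('p, 'b) manifold =
  mtop :: "'p topology"
  atlas :: "('p, 'b) chart set"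

abbreviation points :: "('p, 'b) manifold \<Rightarrow> 'p set" where
  "points M \<equiv> topspace (mtop M)"

definition smooth_manifold :: "('p, 'b::euclidean_space) manifold \<Rightarrow> bool" where
  "smooth_manifold M \<longleftrightarrow>
     Hausdorff_space (mtop M) \<and>
     (\<exists>\<B>. countable \<B> \<and> (\<forall>V\<in>\<B>. openin (mtop M) V) \<and>
        (\<forall>U x. openin (mtop M) U \<and> x \<in> U \<longrightarrow> (\<exists>V\<in>\<B>. x \<in> V \<and> V \<subseteq> U))) \<and>
     (\<forall>c\<in>atlas M. is_chart (mtop M) c) \<and>
     (\<Union>c\<in>atlas M. fst c) = points M \<and>
     (\<forall>c\<in>atlas M. \<forall>d\<in>atlas M. smooth_compatible c d)"

text \<open>Membership in the maximal atlas.\<close>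

definition smooth_chart ::
  "('p, 'b::euclidean_space) manifold \<Rightarrow> ('p, 'b) chart \<Rightarrow> bool" where
  "smooth_chart M c \<longleftrightarrow> is_chart (mtop M) c \<and> (\<forall>d\<in>atlas M. smooth_compatible c d)"

definition smooth_on_open ::
  "('p, 'b::euclidean_space) manifold \<Rightarrow> 'p set \<Rightarrow> ('p \<Rightarrow> real) \<Rightarrow> bool" where
  "smooth_on_open M W f \<longleftrightarrow>
     openin (mtop M) W \<and>
     (\<forall>c\<in>atlas M. smooth_on (f \<circ> chart_inv c) (snd c ` (fst c \<inter> W)))"

text \<open>Smoothness on an arbitrary subset, by local smooth extension. For open \<open>S\<close> this is
  smoothness in charts, and for an embedded submanifold \<open>S\<close> (such as the unit sphere bundle) it
  is smoothness with respect to the manifold structure of \<open>S\<close>.\<close>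

definition C_inf :: "('p, 'b::euclidean_space) manifold \<Rightarrow> 'p set \<Rightarrow> ('p \<Rightarrow> real) set" where
  "C_inf M S =
     {f. S \<subseteq> points M \<and>
         (\<forall>p\<in>S. \<exists>W h. p \<in> W \<and> smooth_on_open M W h \<and> (\<forall>q\<in>S \<inter> W. f q = h q))}"

definition smooth_map ::
  "('p, 'b::euclidean_space) manifold \<Rightarrow> ('q, 'c::euclidean_space) manifold \<Rightarrow> ('p \<Rightarrow> 'q) \<Rightarrow> bool"
where
  "smooth_map M N f \<longleftrightarrow>
     continuous_map (mtop M) (mtop N) f \<and>
     (\<forall>c\<in>atlas M. \<forall>d\<in>atlas N.
        smooth_on (snd d \<circ> f \<circ> chart_inv c) (snd c ` {p \<in> fst c. f p \<in> fst d}))"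

text \<open>A tangent vector at \<open>p\<close> is given by its components \<open>v\<close> in a chart around \<open>p\<close>, components
  in different charts being related by the derivative of the transition map. Thus \<open>g c p v w\<close> is
  the metric at \<open>p\<close> applied to the tangent vectors with components \<open>v\<close> and \<open>w\<close> in the
  chart \<open>c\<close>.\<close>

definition riemannian_metric ::
  "('p, 'b::euclidean_space) manifold \<Rightarrow> (('p, 'b) chart \<Rightarrow> 'p \<Rightarrow> 'b \<Rightarrow> 'b \<Rightarrow> real) \<Rightarrow> bool"
where
  "riemannian_metric M g \<longleftrightarrow>
     (\<forall>c\<in>atlas M. \<forall>p\<in>fst c.
        bilinear (g c p) \<and> (\<forall>v w. g c p v w = g c p w v) \<and> (\<forall>v. v \<noteq> 0 \<longrightarrow> g c p v v > 0)) \<and>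
     (\<forall>c\<in>atlas M. \<forall>v w. smooth_on (\<lambda>y. g c (chart_inv c y) v w) (snd c ` fst c)) \<and>
     (\<forall>c\<in>atlas M. \<forall>d\<in>atlas M. \<forall>p\<in>fst c \<inter> fst d. \<forall>v w.
        g c p v w =
          g d p (frechet_derivative (transition c d) (at (snd c p)) v)
                (frechet_derivative (transition c d) (at (snd c p)) w))"

definition riemannian_manifold ::
  "('p, 'b::euclidean_space) manifold \<Rightarrow> (('p, 'b) chart \<Rightarrow> 'p \<Rightarrow> 'b \<Rightarrow> 'b \<Rightarrow> real) \<Rightarrow> bool"
where
  "riemannian_manifold M g \<longleftrightarrow> smooth_manifold M \<and> riemannian_metric M g"

section \<open>Riemannian vector bundles\<close>

text \<open>The operations \<open>vadd\<close> and \<open>vscale\<close> and the fibre metric \<open>vmetric\<close> are only meaningful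
  for arguments in a common fibre. The typical fibre is \<open>'f\<close>, so the rank is \<open>DIM('f)\<close>.\<close>

record ('p, 'b, 'e, 'f) vbundle =
  base :: "('p, 'b) manifold"
  total :: "('e, 'b \<times> 'f) manifold"
  proj :: "'e \<Rightarrow> 'p"
  vadd :: "'e \<Rightarrow> 'e \<Rightarrow> 'e"
  vscale :: "real \<Rightarrow> 'e \<Rightarrow> 'e"
  vzero :: "'p \<Rightarrow> 'e"
  vmetric :: "'e \<Rightarrow> 'e \<Rightarrow> real"

definition fibre :: "('p, 'b, 'e, 'f) vbundle \<Rightarrow> 'p \<Rightarrow> 'e set" where
  "fibre E x = {\<xi> \<in> points (total E). proj E \<xi> = x}"

definition real_vector_space_on ::
  "'e set \<Rightarrow> ('e \<Rightarrow> 'e \<Rightarrow> 'e) \<Rightarrow> (real \<Rightarrow> 'e \<Rightarrow> 'e) \<Rightarrow> 'e \<Rightarrow> bool" where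
  "real_vector_space_on V add smul zero \<longleftrightarrow>
     zero \<in> V \<and> (\<forall>\<xi>\<in>V. \<forall>\<eta>\<in>V. add \<xi> \<eta> \<in> V) \<and> (\<forall>a. \<forall>\<xi>\<in>V. smul a \<xi> \<in> V) \<and>
     (\<forall>\<xi>\<in>V. \<forall>\<eta>\<in>V. \<forall>\<zeta>\<in>V. add (add \<xi> \<eta>) \<zeta> = add \<xi> (add \<eta> \<zeta>)) \<and>
     (\<forall>\<xi>\<in>V. \<forall>\<eta>\<in>V. add \<xi> \<eta> = add \<eta> \<xi>) \<and>
     (\<forall>\<xi>\<in>V. add zero \<xi> = \<xi>) \<and>
     (\<forall>\<xi>\<in>V. \<exists>\<eta>\<in>V. add \<xi> \<eta> = zero) \<and>
     (\<forall>a. \<forall>\<xi>\<in>V. \<forall>\<eta>\<in>V. smul a (add \<xi> \<eta>) = add (smul a \<xi>) (smul a \<eta>)) \<and>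
     (\<forall>a b. \<forall>\<xi>\<in>V. smul (a + b) \<xi> = add (smul a \<xi>) (smul b \<xi>)) \<and>
     (\<forall>a b. \<forall>\<xi>\<in>V. smul a (smul b \<xi>) = smul (a * b) \<xi>) \<and>
     (\<forall>\<xi>\<in>V. smul 1 \<xi> = \<xi>)"

text \<open>\<open>\<Phi>\<close> is the vector component of a local trivialization \<open>\<xi> \<mapsto> (proj E \<xi>, \<Phi> \<xi>)\<close> over \<open>U\<close>.
  That this map is a diffeomorphism onto the product of \<open>U\<close> and \<open>'f\<close> is expressed by the last
  conjunct: composing it with any chart of the base gives a chart in the maximal atlas of the
  total space.\<close>

definition local_trivialization ::
  "('p, 'b::euclidean_space, 'e, 'f::euclidean_space) vbundle \<Rightarrow> 'p set \<Rightarrow> ('e \<Rightarrow> 'f) \<Rightarrow> bool"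
where
  "local_trivialization E U \<Phi> \<longleftrightarrow>
     openin (mtop (base E)) U \<and>
     (\<forall>x\<in>U.
        bij_betw \<Phi> (fibre E x) UNIV \<and>
        (\<forall>\<xi>\<in>fibre E x. \<forall>\<eta>\<in>fibre E x. \<Phi> (vadd E \<xi> \<eta>) = \<Phi> \<xi> + \<Phi> \<eta>) \<and>
        (\<forall>a. \<forall>\<xi>\<in>fibre E x. \<Phi> (vscale E a \<xi>) = a *\<^sub>R \<Phi> \<xi>)) \<and>
     (\<forall>c\<in>atlas (base E).
        smooth_chart (total E)
          ({\<xi> \<in> points (total E). proj E \<xi> \<in> U \<inter> fst c}, \<lambda>\<xi>. (snd c (proj E \<xi>), \<Phi> \<xi>)))"

definition smooth_vector_bundle ::
  "('p, 'b::euclidean_space, 'e, 'f::euclidean_space) vbundle \<Rightarrow> bool" where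
  "smooth_vector_bundle E \<longleftrightarrow>
     smooth_manifold (base E) \<and> smooth_manifold (total E) \<and>
     smooth_map (total E) (base E) (proj E) \<and>
     (\<forall>x\<in>points (base E). real_vector_space_on (fibre E x) (vadd E) (vscale E) (vzero E x)) \<and>
     (\<forall>x\<in>points (base E). \<exists>U \<Phi>. x \<in> U \<and> local_trivialization E U \<Phi>)"

text \<open>Smoothness of the fibre metric is stated in the local frames given by local
  trivializations.\<close>

definition riemannian_vector_bundle ::
  "('p, 'b::euclidean_space, 'e, 'f::euclidean_space) vbundle \<Rightarrow> bool" where
  "riemannian_vector_bundle E \<longleftrightarrow>
     smooth_vector_bundle E \<and>
     (\<forall>x\<in>points (base E).
        (\<forall>\<xi>\<in>fibre E x. \<forall>\<eta>\<in>fibre E x. vmetric E \<xi> \<eta> = vmetric E \<eta> \<xi>) \<and>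
        (\<forall>\<xi>\<in>fibre E x. \<forall>\<eta>\<in>fibre E x. \<forall>\<zeta>\<in>fibre E x.
           vmetric E (vadd E \<xi> \<eta>) \<zeta> = vmetric E \<xi> \<zeta> + vmetric E \<eta> \<zeta>) \<and>
        (\<forall>a. \<forall>\<xi>\<in>fibre E x. \<forall>\<eta>\<in>fibre E x. vmetric E (vscale E a \<xi>) \<eta> = a * vmetric E \<xi> \<eta>) \<and>
        (\<forall>\<xi>\<in>fibre E x. \<xi> \<noteq> vzero E x \<longrightarrow> vmetric E \<xi> \<xi> > 0)) \<and>
     (\<forall>U \<Phi>. local_trivialization E U \<Phi> \<longrightarrow>
        (\<forall>v w. smooth_on_open (base E) U
           (\<lambda>x. vmetric E (inv_into (fibre E x) \<Phi> v) (inv_into (fibre E x) \<Phi> w))))"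

definition vnorm :: "('p, 'b, 'e, 'f) vbundle \<Rightarrow> 'e \<Rightarrow> real" where
  "vnorm E \<xi> = sqrt (vmetric E \<xi> \<xi>)"

definition punctured :: "('p, 'b, 'e, 'f) vbundle \<Rightarrow> 'e set" where
  "punctured E = {\<xi> \<in> points (total E). \<xi> \<noteq> vzero E (proj E \<xi>)}"

definition sphere_bundle :: "('p, 'b, 'e, 'f) vbundle \<Rightarrow> 'e set" where
  "sphere_bundle E = {\<xi> \<in> points (total E). vnorm E \<xi> = 1}"

definition radial_graph :: "('p, 'b, 'e, 'f) vbundle \<Rightarrow> ('e \<Rightarrow> real) \<Rightarrow> 'e set" where
  "radial_graph E u = (\<lambda>\<xi>. vscale E (exp (u \<xi>)) \<xi>) ` sphere_bundle E"

section \<open>Mean curvature of hypersurfaces\<close>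

definition smooth_hypersurface :: "'v::euclidean_space set \<Rightarrow> bool" where
  "smooth_hypersurface S \<longleftrightarrow>
     (\<forall>p\<in>S. \<exists>W (F :: 'v \<Rightarrow> real). open W \<and> p \<in> W \<and> smooth_on F W \<and>
        (\<forall>q\<in>W. q \<in> S \<longleftrightarrow> F q = 0) \<and> frechet_derivative F (at p) \<noteq> (\<lambda>v. 0))"

definition tangent_space :: "'v::euclidean_space set \<Rightarrow> 'v \<Rightarrow> 'v set" where
  "tangent_space S p =
     {v. \<exists>(c :: real \<Rightarrow> 'v) e. e > 0 \<and> smooth_on c {-e<..<e} \<and> c ` {-e<..<e} \<subseteq> S \<and>
           c 0 = p \<and> (c has_vector_derivative v) (at 0)}"

definition outward_unit_normal :: "'v::euclidean_space set \<Rightarrow> 'v \<Rightarrow> 'v \<Rightarrow> bool" where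
  "outward_unit_normal S p \<nu> \<longleftrightarrow>
     norm \<nu> = 1 \<and> (\<forall>v\<in>tangent_space S p. \<nu> \<bullet> v = 0) \<and> \<nu> \<bullet> p > 0"

definition orthonormal_basis_of :: "'v::euclidean_space set \<Rightarrow> 'v set \<Rightarrow> bool" where
  "orthonormal_basis_of T B \<longleftrightarrow> pairwise orthogonal B \<and> (\<forall>b\<in>B. norm b = 1) \<and> span B = T"

text \<open>\<open>N\<close> is a smooth extension of the outward unit normal field to an ambient neighbourhood
  of \<open>p\<close>; for tangent \<open>X\<close> its derivative in direction \<open>X\<close> depends only on the values on \<open>S\<close>.\<close>

definition second_fundamental_form ::
  "('v::euclidean_space \<Rightarrow> 'v) \<Rightarrow> 'v \<Rightarrow> 'v \<Rightarrow> 'v \<Rightarrow> real" where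
  "second_fundamental_form N p X Y = frechet_derivative N (at p) X \<bullet> Y"

definition has_mean_curvature :: "'v::euclidean_space set \<Rightarrow> 'v \<Rightarrow> real \<Rightarrow> bool" where
  "has_mean_curvature S p H \<longleftrightarrow>
     smooth_hypersurface S \<and> p \<in> S \<and>
     (\<exists>W N. open W \<and> p \<in> W \<and> smooth_on N W \<and> (\<forall>q\<in>S \<inter> W. outward_unit_normal S q (N q)) \<and>
        (\<forall>B. orthonormal_basis_of (tangent_space S p) B \<longrightarrow>
           H = (\<Sum>X\<in>B. second_fundamental_form N p X X)))"

definition fibre_isometry ::
  "('p, 'b, 'e, 'f::euclidean_space) vbundle \<Rightarrow> 'p \<Rightarrow> ('f \<Rightarrow> 'e) \<Rightarrow> bool" where
  "fibre_isometry E x L \<longleftrightarrow>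
     bij_betw L UNIV (fibre E x) \<and>
     (\<forall>v w. L (v + w) = vadd E (L v) (L w)) \<and> (\<forall>a v. L (a *\<^sub>R v) = vscale E a (L v)) \<and>
     (\<forall>v w. vmetric E (L v) (L w) = v \<bullet> w)"

text \<open>The fibre through \<open>\<eta>\<close> is treated as a Euclidean space by identifying it with \<open>'f\<close> through
  a linear isometry; the value is required to be the same for all such identifications.\<close>

definition vertical_mean_curvature ::
  "('p, 'b, 'e, 'f::euclidean_space) vbundle \<Rightarrow> 'e set \<Rightarrow> 'e \<Rightarrow> real" where
  "vertical_mean_curvature E Y \<eta> =
     (THE H. \<forall>L. fibre_isometry E (proj E \<eta>) L \<longrightarrow>
        has_mean_curvature (L -` (Y \<inter> fibre E (proj E \<eta>))) (inv L \<eta>) H)"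

end

theory Submission
  imports Defs
begin

text \<open>In a fibre of rank \<open>m\<close> the sphere of radius \<open>r\<close> has mean curvature \<open>(m - 1) / r\<close>. As the
  prescribed function is a constant \<open>k x\<close> on each punctured fibre, it suffices to choose in the
  fibre over \<open>x\<close> the sphere of radius \<open>(m - 1) / k x\<close>, that is, \<open>u = ln ((m - 1) / K)\<close>, and
  no differential equation has to be solved. What remains is to check that this \<open>u\<close> is smooth
  and that the vertical mean curvature, defined by a unique description, really takes the
  expected value.

  For the smoothness, \<open>K\<close> is smooth on the punctured bundle, which contains the unit sphere
  bundle, so \<open>u\<close> is obtained from \<open>K\<close> by post-composition with a smooth function on the positive
  reals (\<open>C_inf_ln_divide\<close>); this avoids pulling \<open>k\<close> back along the projection.

  For the curvature, a linear isometry of the fibre with the model space turns the fibre of the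
  graph into the round sphere (\<open>radial_graph_fibre\<close>). There \<open>q \<mapsto> q / r\<close> extends the unit normal
  field, and every other extension has the same derivative in tangential directions, so that
  \<open>(m - 1) / r\<close> is the one and only value of the mean curvature (\<open>has_mean_curvature_sphere\<close>).
  The description therefore determines a number as soon as the fibre admits an isometry at all,
  which is the Gram-Schmidt process (\<open>fibre_isometry_exists\<close>).\<close>

section \<open>Smooth functions on open sets\<close>

lemma Ck_on_subset: "Ck_on k f S \<Longrightarrow> T \<subseteq> S \<Longrightarrow> Ck_on k f T"
  by (induction k arbitrary: f) (auto intro: continuous_on_subset)

lemma Ck_on_Suc_imp: "Ck_on (Suc k) f S \<Longrightarrow> Ck_on k f S"
proof (induction k arbitrary: f)
  case 0
  then show ?case
    by (auto intro!: differentiable_imp_continuous_on differentiable_at_imp_differentiable_on)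
next
  case (Suc k)
  then show ?case by (metis Ck_on.simps(2))
qed

lemma Ck_on_cong:
  assumes "open S" "\<And>x. x \<in> S \<Longrightarrow> f x = g x"
  shows "Ck_on k f S \<longleftrightarrow> Ck_on k g S"
  using assms(2)
proof (induction k arbitrary: f g)
  case 0
  then show ?case by (simp cong: continuous_on_cong)
next
  case (Suc k)
  have der: "(f has_derivative D) (at x) \<longleftrightarrow> (g has_derivative D) (at x)" if "x \<in> S" for x D
    using has_derivative_transform_within_open[OF _ assms(1) that] Suc.prems by metis
  have "frechet_derivative f (at x) = frechet_derivative g (at x)" if "x \<in> S" for x
    unfolding frechet_derivative_def using der[OF that] by simp
  then have "Ck_on k (\<lambda>x. frechet_derivative f (at x) v) S \<longleftrightarrow>
      Ck_on k (\<lambda>x. frechet_derivative g (at x) v) S" for v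
    by (intro Suc.IH) simp
  moreover have "f differentiable (at x) \<longleftrightarrow> g differentiable (at x)" if "x \<in> S" for x
    unfolding differentiable_def using der[OF that] by simp
  ultimately show ?case by simp
qed

lemma Ck_on_Suc_I:
  assumes "open S" "\<And>x. x \<in> S \<Longrightarrow> (f has_derivative D x) (at x)"
    and "\<And>v. Ck_on k (\<lambda>x. D x v) S"
  shows "Ck_on (Suc k) f S"
proof -
  have "frechet_derivative f (at x) = D x" if "x \<in> S" for x
    using assms(2)[OF that] by (metis frechet_derivative_at)
  then have "Ck_on k (\<lambda>x. frechet_derivative f (at x) v) S" for v
    using Ck_on_cong[OF assms(1), of "\<lambda>x. frechet_derivative f (at x) v" "\<lambda>x. D x v"] assms(3)
    by simp
  then show ?thesis using assms(2) by (auto simp: differentiable_def)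
qed

lemma Ck_on_Suc_D:
  assumes "Ck_on (Suc k) f S"
  shows "x \<in> S \<Longrightarrow> (f has_derivative frechet_derivative f (at x)) (at x)"
    and "Ck_on k (\<lambda>x. frechet_derivative f (at x) v) S"
  using assms by (auto simp: frechet_derivative_works)

lemma Ck_on_const: "Ck_on k (\<lambda>x. c) S"
  by (induction k arbitrary: c) auto

lemma Ck_on_add:
  assumes "open S"
  shows "Ck_on k f S \<Longrightarrow> Ck_on k g S \<Longrightarrow> Ck_on k (\<lambda>x. f x + g x) S"
proof (induction k arbitrary: f g)
  case 0
  then show ?case by (simp add: continuous_on_add)
next
  case (Suc k)
  note fg = Suc.prems
  show ?case
    by (rule Ck_on_Suc_I[OF assms
        has_derivative_add[OF Ck_on_Suc_D(1)[OF fg(1)] Ck_on_Suc_D(1)[OF fg(2)]]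
        Suc.IH[OF Ck_on_Suc_D(2)[OF fg(1)] Ck_on_Suc_D(2)[OF fg(2)]]])
qed

lemma Ck_on_mult:
  fixes f g :: "'a::euclidean_space \<Rightarrow> real"
  assumes "open S"
  shows "Ck_on k f S \<Longrightarrow> Ck_on k g S \<Longrightarrow> Ck_on k (\<lambda>x. f x * g x) S"
proof (induction k arbitrary: f g)
  case 0
  then show ?case by (simp add: continuous_on_mult)
next
  case (Suc k)
  note fg = Suc.prems
  show ?case
  proof (rule Ck_on_Suc_I[OF assms])
    show "((\<lambda>x. f x * g x) has_derivative
        (\<lambda>v. f x * frechet_derivative g (at x) v + frechet_derivative f (at x) v * g x)) (at x)"
      if "x \<in> S" for x
      by (rule has_derivative_mult[OF Ck_on_Suc_D(1)[OF fg(1) that] Ck_on_Suc_D(1)[OF fg(2) that]])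
    show "Ck_on k (\<lambda>x. f x * frechet_derivative g (at x) v + frechet_derivative f (at x) v * g x) S"
      for v
      by (rule Ck_on_add[OF assms Suc.IH[OF Ck_on_Suc_imp[OF fg(1)] Ck_on_Suc_D(2)[OF fg(2)]]
          Suc.IH[OF Ck_on_Suc_D(2)[OF fg(1)] Ck_on_Suc_imp[OF fg(2)]]])
  qed
qed

lemma Ck_on_inverse:
  fixes f :: "'a::euclidean_space \<Rightarrow> real"
  assumes "open S" "\<And>x. x \<in> S \<Longrightarrow> f x \<noteq> 0"
  shows "Ck_on k f S \<Longrightarrow> Ck_on k (\<lambda>x. inverse (f x)) S"
proof (induction k)
  case 0
  then show ?case using assms by (simp add: continuous_on_inverse)
next
  case (Suc k)
  have inv: "Ck_on k (\<lambda>x. inverse (f x)) S"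
    using Suc Ck_on_Suc_imp by blast
  show ?case
  proof (rule Ck_on_Suc_I[OF assms(1)])
    fix x assume x: "x \<in> S"
    show "((\<lambda>x. inverse (f x)) has_derivative
        (\<lambda>v. (- 1) * (inverse (f x) * (frechet_derivative f (at x) v * inverse (f x))))) (at x)"
      using Deriv.has_derivative_inverse[OF assms(2)[OF x] Ck_on_Suc_D(1)[OF Suc.prems x]]
      by (simp only: mult.assoc mult_minus1)
  next
    show "Ck_on k (\<lambda>x. (- 1) * (inverse (f x) *
        (frechet_derivative f (at x) v * inverse (f x)))) S" for v
      using Ck_on_mult[OF assms(1) Ck_on_const Ck_on_mult[OF assms(1) inv
        Ck_on_mult[OF assms(1) Ck_on_Suc_D(2)[OF Suc.prems] inv]]] .
  qed
qed

lemma Ck_on_ln: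
  fixes f :: "'a::euclidean_space \<Rightarrow> real"
  assumes "open S" "\<And>x. x \<in> S \<Longrightarrow> f x > 0" "Ck_on k f S"
  shows "Ck_on k (\<lambda>x. ln (f x)) S"
proof -
  have nz: "f x \<noteq> 0" if "x \<in> S" for x using assms(2)[OF that] by linarith
  show ?thesis
  proof (cases k)
    case 0
    have "continuous_on S f" using assms(3) unfolding 0 Ck_on.simps .
    then show ?thesis
      unfolding 0 Ck_on.simps by (rule continuous_on_ln) (use nz in blast)
  next
    case (Suc j)
    have f: "Ck_on (Suc j) f S" using assms(3) unfolding Suc .
    show ?thesis unfolding Suc
    proof (rule Ck_on_Suc_I[OF assms(1)])
      fix x assume x: "x \<in> S"
      show "((\<lambda>x. ln (f x)) has_derivative
          (\<lambda>v. frechet_derivative f (at x) v * inverse (f x))) (at x)"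
        by (rule has_derivative_ln[OF assms(2)[OF x] Ck_on_Suc_D(1)[OF f x]])
    next
      show "Ck_on j (\<lambda>x. frechet_derivative f (at x) v * inverse (f x)) S" for v
        by (rule Ck_on_mult[OF assms(1) Ck_on_Suc_D(2)[OF f]
          Ck_on_inverse[OF assms(1) nz Ck_on_Suc_imp[OF f]]])
    qed
  qed
qed

lemma Ck_on_linear:
  assumes "bounded_linear f" "open S"
  shows "Ck_on k f S"
proof (cases k)
  case 0
  then show ?thesis using assms by (simp add: linear_continuous_on)
next
  case (Suc j)
  show ?thesis unfolding Suc
    by (rule Ck_on_Suc_I[OF assms(2) bounded_linear_imp_has_derivative[OF assms(1)] Ck_on_const])
qed

section \<open>Mean curvature of round spheres\<close>

text \<open>The family of such curves is closed under differentiation, up to a change of the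
  coefficient vectors; hence the statement is proved for all of them at once.\<close>

lemma Ck_on_trig:
  "open S \<Longrightarrow> Ck_on k (\<lambda>t. cos (\<omega> * t) *\<^sub>R a + sin (\<omega> * t) *\<^sub>R b) S"
proof (induction k arbitrary: a b)
  case 0
  then show ?case by (auto intro!: continuous_intros)
next
  case (Suc k)
  show ?case
  proof (rule Ck_on_Suc_I[OF Suc.prems])
    show "((\<lambda>t. cos (\<omega> * t) *\<^sub>R a + sin (\<omega> * t) *\<^sub>R b) has_derivative
        (\<lambda>s. cos (\<omega> * t) *\<^sub>R ((s * \<omega>) *\<^sub>R b) + sin (\<omega> * t) *\<^sub>R ((- s * \<omega>) *\<^sub>R a))) (at t)" for t
      by (auto intro!: derivative_eq_intros simp: algebra_simps)
    show "Ck_on k (\<lambda>t. cos (\<omega> * t) *\<^sub>R ((s * \<omega>) *\<^sub>R b) + sin (\<omega> * t) *\<^sub>R ((- s * \<omega>) *\<^sub>R a)) S" for s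
      by (rule Suc.IH[OF Suc.prems])
  qed
qed

text \<open>Tangent vectors are realised by great circles: \<open>v\<close> orthogonal to \<open>p\<close> is the initial
  velocity of \<open>t \<mapsto> cos (\<omega> t) p + sin (\<omega> t) v / \<omega>\<close> with \<open>\<omega> = norm v / r\<close>.\<close>

lemma tangent_space_sphere:
  fixes p :: "'v::euclidean_space"
  assumes r: "r > 0" and p: "norm p = r"
  shows "tangent_space (sphere 0 r) p = {v. p \<bullet> v = 0}"
proof (intro set_eqI iffI)
  fix v assume "v \<in> tangent_space (sphere 0 r) p"
  then obtain c e where c: "e > 0" "c ` {-e<..<e} \<subseteq> sphere 0 r" "c 0 = p"
    "(c has_vector_derivative v) (at (0::real))"
    unfolding tangent_space_def by blast
  have "((\<lambda>t. c t \<bullet> c t) has_derivative (\<lambda>s. c 0 \<bullet> (s *\<^sub>R v) + (s *\<^sub>R v) \<bullet> c 0)) (at 0)"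
    using c(4) unfolding has_vector_derivative_def by (intro has_derivative_inner)
  moreover have "((\<lambda>t. c t \<bullet> c t) has_derivative (\<lambda>s. 0)) (at 0)"
  proof (rule has_derivative_transform_within_open[of "\<lambda>t. r\<^sup>2" _ _ _ "{-e<..<e}"])
    show "r\<^sup>2 = c t \<bullet> c t" if "t \<in> {-e<..<e}" for t
      using c(2) that by (auto simp: dot_square_norm image_subset_iff)
  qed (use c(1) in auto)
  ultimately have "(\<lambda>s. c 0 \<bullet> (s *\<^sub>R v) + (s *\<^sub>R v) \<bullet> c 0) = (\<lambda>s. 0)"
    by (rule has_derivative_unique)
  from fun_cong[OF this, of 1] show "v \<in> {v. p \<bullet> v = 0}"
    using c(3) by (simp add: inner_commute)
next
  fix v assume "v \<in> {v. p \<bullet> v = 0}"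
  then have orth: "p \<bullet> v = 0" by simp
  define \<omega> where "\<omega> = norm v / r"
  define c where "c = (\<lambda>t. cos (\<omega> * t) *\<^sub>R p + sin (\<omega> * t) *\<^sub>R (v /\<^sub>R \<omega>))"
  \<comment> \<open>If \<open>v = 0\<close>, then \<open>\<omega> = 0\<close> and \<open>c\<close> is the constant curve.\<close>
  have wv: "norm (v /\<^sub>R \<omega>) = r \<or> \<omega> = 0" "\<omega> *\<^sub>R (v /\<^sub>R \<omega>) = v"
    using r by (auto simp: \<omega>_def)
  have "c t \<bullet> c t = r\<^sup>2" for t
  proof -
    have "c t \<bullet> c t = (cos (\<omega> * t))\<^sup>2 * (p \<bullet> p) + (sin (\<omega> * t))\<^sup>2 * ((v /\<^sub>R \<omega>) \<bullet> (v /\<^sub>R \<omega>))"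
      using orth unfolding c_def
      by (simp add: inner_add_left inner_add_right inner_commute[of v p] power2_eq_square)
    also have "\<dots> = (cos (\<omega> * t))\<^sup>2 * r\<^sup>2 + (sin (\<omega> * t))\<^sup>2 * r\<^sup>2"
      using wv(1) p unfolding dot_square_norm by auto
    also have "\<dots> = r\<^sup>2"
      by (simp flip: distrib_right)
    finally show ?thesis .
  qed
  then have "c ` {-1<..<1} \<subseteq> sphere 0 r"
    using r by (auto simp: dot_square_norm)
  moreover have "smooth_on c {-1<..<1}"
    unfolding smooth_on_def c_def using Ck_on_trig[OF open_greaterThanLessThan] by (intro allI)
  moreover have "(c has_vector_derivative \<omega> *\<^sub>R (v /\<^sub>R \<omega>)) (at 0)"
    unfolding c_def has_vector_derivative_def
    by (auto intro!: derivative_eq_intros simp: algebra_simps)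
  moreover have "c 0 = p" by (simp add: c_def)
  ultimately show "v \<in> tangent_space (sphere 0 r) p"
    unfolding tangent_space_def wv(2) by (auto intro!: exI[of _ c] exI[of _ "1::real"])
qed

lemma outward_unit_normal_sphere:
  fixes p :: "'v::euclidean_space"
  assumes r: "r > 0" and p: "norm p = r"
  shows "outward_unit_normal (sphere 0 r) p \<nu> \<longleftrightarrow> \<nu> = p /\<^sub>R r"
proof
  assume "outward_unit_normal (sphere 0 r) p \<nu>"
  then have \<nu>: "norm \<nu> = 1" "\<And>v. p \<bullet> v = 0 \<Longrightarrow> \<nu> \<bullet> v = 0" "\<nu> \<bullet> p > 0"
    unfolding outward_unit_normal_def tangent_space_sphere[OF assms] by auto
  have pp: "p \<bullet> p = r\<^sup>2" using p by (simp add: dot_square_norm)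
  define a where "a = (\<nu> \<bullet> p) / r\<^sup>2"
  \<comment> \<open>The component of \<open>\<nu>\<close> tangent to the sphere, which is orthogonal to itself.\<close>
  define v where "v = \<nu> - a *\<^sub>R p"
  have pv: "p \<bullet> v = 0"
    using r pp by (simp add: v_def a_def inner_diff_right inner_commute)
  then have "v \<bullet> v = 0"
    using \<nu>(2)[OF pv] by (subst v_def) (simp add: inner_diff_left)
  then have na: "\<nu> = a *\<^sub>R p" by (simp add: v_def)
  have "a > 0" using \<nu>(3) r by (simp add: a_def)
  then have "a * r = 1" using \<nu>(1) p na by simp
  then show "\<nu> = p /\<^sub>R r" using na r by (simp add: field_simps)
next
  assume "\<nu> = p /\<^sub>R r"
  then show "outward_unit_normal (sphere 0 r) p \<nu>"
    using r p unfolding outward_unit_normal_def tangent_space_sphere[OF assms]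
    by (auto simp: dot_square_norm)
qed

lemma smooth_hypersurface_sphere:
  assumes "r > 0"
  shows "smooth_hypersurface (sphere (0::'v::euclidean_space) r)"
  unfolding smooth_hypersurface_def
proof
  fix p :: 'v assume p: "p \<in> sphere 0 r"
  define F where "F = (\<lambda>q::'v. q \<bullet> q + (- r\<^sup>2))"
  have der: "(F has_derivative (\<lambda>v. (2 *\<^sub>R v) \<bullet> q)) (at q)" for q
    unfolding F_def by (auto intro!: derivative_eq_intros simp: inner_commute)
  have lin: "bounded_linear (\<lambda>q. (2 *\<^sub>R v) \<bullet> q)" for v :: 'v
    by (rule bounded_linear_inner_right)
  have "Ck_on k F UNIV" for k
  proof (cases k)
    case 0
    then show ?thesis unfolding F_def by (auto intro!: continuous_intros)
  next
    case (Suc j)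
    then show ?thesis
      using Ck_on_Suc_I[of UNIV F "\<lambda>q v. (2 *\<^sub>R v) \<bullet> q" j] der Ck_on_linear[OF lin] by blast
  qed
  then have "smooth_on F UNIV" by (simp add: smooth_on_def)
  moreover have "frechet_derivative F (at p) = (\<lambda>v. (2 *\<^sub>R v) \<bullet> p)"
    using der by (metis frechet_derivative_at)
  moreover have "(2 *\<^sub>R p) \<bullet> p \<noteq> 0" using p assms by auto
  moreover have "q \<in> sphere 0 r \<longleftrightarrow> F q = 0" for q
    using assms by (auto simp: F_def dot_square_norm)
  ultimately show "\<exists>W (F::'v \<Rightarrow> real). open W \<and> p \<in> W \<and> smooth_on F W \<and>
      (\<forall>q\<in>W. q \<in> sphere 0 r \<longleftrightarrow> F q = 0) \<and> frechet_derivative F (at p) \<noteq> (\<lambda>v. 0)"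
    by (intro exI[of _ UNIV] exI[of _ F]) (auto dest: fun_cong[of _ _ p])
qed

lemma card_orthonormal_basis_of:
  assumes "orthonormal_basis_of T B"
  shows "card B = dim T"
proof -
  have "0 \<notin> B" using assms by (auto simp: orthonormal_basis_of_def)
  then have "independent B"
    using assms pairwise_orthogonal_independent unfolding orthonormal_basis_of_def by blast
  then show ?thesis
    using assms dim_eq_card_independent dim_span unfolding orthonormal_basis_of_def by metis
qed

text \<open>Every admissible extension \<open>N\<close> of the normal field agrees with \<open>q \<mapsto> q / r\<close> along each
  curve in the sphere, so the shape operator is \<open>1 / r\<close> times the identity and its trace over the
  \<open>DIM('v) - 1\<close> tangent directions is determined.\<close>

lemma has_mean_curvature_sphere:
  fixes p :: "'v::euclidean_space"
  assumes r: "r > 0" and p: "norm p = r"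
  shows "has_mean_curvature (sphere 0 r) p H \<longleftrightarrow> H = (real DIM('v) - 1) / r"
proof -
  let ?S = "sphere (0::'v) r" and ?T = "{v. p \<bullet> v = 0}"
  have p0: "p \<noteq> 0" using r p by auto
  have dim: "dim ?T = DIM('v) - 1" using dim_hyperplane[OF p0] .
  have sff: "second_fundamental_form N p X X = 1 / r"
    if N: "open W" "p \<in> W" "smooth_on N W" "\<forall>q\<in>?S \<inter> W. outward_unit_normal ?S q (N q)"
      and X: "X \<in> ?T" "norm X = 1" for N W X
  proof -
    \<comment> \<open>Along a curve in the sphere with velocity \<open>X\<close> the field \<open>N\<close> is known explicitly.\<close>
    obtain c e where c: "e > 0" "c ` {-e<..<e} \<subseteq> ?S" "c 0 = p"
      "(c has_vector_derivative X) (at (0::real))"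
      using X(1) unfolding tangent_space_sphere[OF assms, symmetric] tangent_space_def by blast
    have "Ck_on (Suc 0) N W" using N(3) unfolding smooth_on_def by blast
    then have "(N has_derivative frechet_derivative N (at p)) (at (c 0))"
      using Ck_on_Suc_D(1) N(2) c(3) by metis
    then have d1: "(N \<circ> c has_vector_derivative frechet_derivative N (at p) X) (at 0)"
      using vector_derivative_diff_chain_within[OF c(4), of N]
      by (metis has_derivative_at_withinI)
    have "isCont c 0" using c(4) has_vector_derivative_continuous by blast
    then have "\<forall>\<^sub>F t in at 0. c t \<in> W"
      using N(1,2) c(3) unfolding isCont_def by (metis topological_tendstoD)
    moreover have "\<forall>\<^sub>F t in at 0. t \<in> {-e<..<e}"
      using c(1) by (intro eventually_at_in_open') auto
    ultimately have "\<forall>\<^sub>F t in at 0. c t /\<^sub>R r = (N \<circ> c) t"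
    proof eventually_elim
      case (elim t)
      then have "c t \<in> ?S \<inter> W" using c(2) by blast
      then have "norm (c t) = r" "outward_unit_normal ?S (c t) (N (c t))" using N(4) by auto
      then have "N (c t) = c t /\<^sub>R r"
        using outward_unit_normal_sphere[OF r] by blast
      then show ?case by simp
    qed
    moreover have "c 0 /\<^sub>R r = (N \<circ> c) 0"
    proof -
      have "outward_unit_normal ?S p (N p)" using N(2,4) p by simp
      then have "N p = p /\<^sub>R r" using outward_unit_normal_sphere[OF r p] by blast
      then show ?thesis using c(3) by simp
    qed
    moreover have "((\<lambda>t. c t /\<^sub>R r) has_vector_derivative X /\<^sub>R r) (at 0)"
      using bounded_linear.has_vector_derivative[OF bounded_linear_scaleR_right c(4)] .
    ultimately have "(N \<circ> c has_vector_derivative X /\<^sub>R r) (at 0)"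
      unfolding has_vector_derivative_def using has_derivative_transform_eventually by blast
    then have "frechet_derivative N (at p) X = X /\<^sub>R r"
      using vector_derivative_unique_at d1 by blast
    then show ?thesis
      using X(2) by (simp add: second_fundamental_form_def dot_square_norm inverse_eq_divide)
  qed
  have trace: "(\<Sum>X\<in>B. second_fundamental_form N p X X) = (real DIM('v) - 1) / r"
    if "open W" "p \<in> W" "smooth_on N W" "\<forall>q\<in>?S \<inter> W. outward_unit_normal ?S q (N q)"
      and B: "orthonormal_basis_of ?T B" for N W B
  proof -
    have "X \<in> ?T" "norm X = 1" if "X \<in> B" for X
      using B that span_superset unfolding orthonormal_basis_of_def by blast+
    then have "(\<Sum>X\<in>B. second_fundamental_form N p X X) = (\<Sum>X\<in>B. 1 / r)"
      using sff[OF that(1-4)] by (intro sum.cong) auto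
    then show ?thesis
      using card_orthonormal_basis_of[OF B] dim DIM_positive[where 'a='v] by (simp add: of_nat_diff)
  qed
  show ?thesis
  proof
    assume "has_mean_curvature ?S p H"
    then obtain W N where N: "open W" "p \<in> W" "smooth_on N W"
      "\<forall>q\<in>?S \<inter> W. outward_unit_normal ?S q (N q)"
      and H: "\<And>B. orthonormal_basis_of ?T B \<Longrightarrow> H = (\<Sum>X\<in>B. second_fundamental_form N p X X)"
      unfolding has_mean_curvature_def tangent_space_sphere[OF assms] by blast
    obtain B where "pairwise orthogonal B" "\<And>x. x \<in> B \<Longrightarrow> norm x = 1" "span B = ?T"
      using orthonormal_basis_subspace[OF subspace_hyperplane, of p] by metis
    then have "orthonormal_basis_of ?T B" by (simp add: orthonormal_basis_of_def)
    then show "H = (real DIM('v) - 1) / r" using H trace[OF N] by simp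
  next
    assume H: "H = (real DIM('v) - 1) / r"
    define N where "N = (\<lambda>q::'v. q /\<^sub>R r)"
    have "outward_unit_normal ?S q (N q)" if "q \<in> ?S" for q
      using outward_unit_normal_sphere[OF r, of q "N q"] that by (simp add: N_def)
    then have N: "smooth_on N UNIV" "\<forall>q\<in>?S \<inter> UNIV. outward_unit_normal ?S q (N q)"
      unfolding smooth_on_def N_def
      using Ck_on_linear[OF bounded_linear_scaleR_right open_UNIV] by blast+
    show "has_mean_curvature ?S p H"
      unfolding has_mean_curvature_def tangent_space_sphere[OF assms]
      using smooth_hypersurface_sphere[OF r] p N H trace[OF open_UNIV UNIV_I N]
      by (intro conjI exI[of _ UNIV] exI[of _ N]) auto
  qed
qed

section \<open>Isometries of the fibres with Euclidean space\<close>

text \<open>The Gram-Schmidt process for an inner product other than the given one.\<close>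

lemma orthonormal_set_exists:
  fixes ip :: "'f::euclidean_space \<Rightarrow> 'f \<Rightarrow> real"
  assumes bil: "bilinear ip" and pos: "\<And>v. v \<noteq> 0 \<Longrightarrow> ip v v > 0"
    and sym: "\<And>v w. ip v w = ip w v"
  shows "n \<le> DIM('f) \<Longrightarrow>
    \<exists>B. finite B \<and> card B = n \<and> (\<forall>b\<in>B. \<forall>c\<in>B. ip b c = (if b = c then 1 else 0))"
proof (induction n)
  case 0
  then show ?case by (intro exI[of _ "{}"]) simp
next
  case (Suc n)
  then obtain B where B: "finite B" "card B = n"
    and on: "\<And>b c. b \<in> B \<Longrightarrow> c \<in> B \<Longrightarrow> ip b c = (if b = c then 1 else 0)"
    by auto
  have linl: "linear (\<lambda>v. ip v w)" for w
    using bil by (simp add: bilinear_def)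
  have "dim (span B) < DIM('f)"
    using Suc.prems B dim_le_card'[of B] by simp
  then have "span B \<noteq> UNIV" by (metis dim_UNIV less_irrefl)
  then obtain v where v: "v \<notin> span B" by blast
  define w where "w = v - (\<Sum>b\<in>B. ip v b *\<^sub>R b)"
  have "(\<Sum>b\<in>B. ip v b *\<^sub>R b) \<in> span B"
    by (intro span_sum span_scale span_base)
  then have "w \<noteq> 0" using v by (auto simp: w_def)
  then have ww: "ip w w > 0" by (rule pos)
  have wc: "ip w c = 0" if "c \<in> B" for c
  proof -
    have "ip w c = ip v c - (\<Sum>b\<in>B. ip v b * ip b c)"
      unfolding w_def
      by (simp add: linear_diff[OF linl] linear_sum[OF linl] linear_scale[OF linl])
    also have "(\<Sum>b\<in>B. ip v b * ip b c) = (\<Sum>b\<in>B. if b = c then ip v b else 0)"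
      using on that by (intro sum.cong) auto
    finally show ?thesis using B that by simp
  qed
  define e where "e = w /\<^sub>R sqrt (ip w w)"
  have ec: "ip e c = 0" if "c \<in> B" for c
    using wc[OF that] by (simp add: e_def linear_scale[OF linl])
  have ee: "ip e e = 1"
  proof -
    define s where "s = sqrt (ip w w)"
    have s: "s \<noteq> 0" "ip w w = s * s" using ww by (simp_all add: s_def)
    have "ip e e = inverse s * (inverse s * ip w w)"
      unfolding e_def bilinear_lmul[OF bil] bilinear_rmul[OF bil] s_def by simp
    also have "\<dots> = (inverse s * s) * (inverse s * s)" unfolding s(2) by (simp only: mult.assoc mult.left_commute)
    also have "\<dots> = 1" using s(1) by simp
    finally show ?thesis .
  qed
  have "e \<notin> B" using ec ee by force
  then have "card (insert e B) = Suc n" using B by simp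
  moreover have "\<forall>b\<in>insert e B. \<forall>c\<in>insert e B. ip b c = (if b = c then 1 else 0)"
  proof (intro ballI)
    fix b c assume "b \<in> insert e B" "c \<in> insert e B"
    then show "ip b c = (if b = c then 1 else 0)"
      using on[of b c] ec[of b] ec[of c] ee \<open>e \<notin> B\<close> sym[of b e] by fastforce
  qed
  ultimately show ?case using B(1) by blast
qed

text \<open>The isometry sends the standard basis to an orthonormal set of full cardinality.\<close>

lemma isometry_to_inner_product:
  fixes ip :: "'f::euclidean_space \<Rightarrow> 'f \<Rightarrow> real"
  assumes bil: "bilinear ip" and pos: "\<And>v. v \<noteq> 0 \<Longrightarrow> ip v v > 0"
    and sym: "\<And>v w. ip v w = ip w v"
  obtains A :: "'f \<Rightarrow> 'f" where "linear A" "bij A" "\<And>v w. ip (A v) (A w) = v \<bullet> w"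
proof -
  obtain B where B: "finite B" "card B = DIM('f)"
    and on: "\<And>b c. b \<in> B \<Longrightarrow> c \<in> B \<Longrightarrow> ip b c = (if b = c then 1 else 0)"
    using orthonormal_set_exists[OF assms, of "DIM('f)"] by auto
  then obtain f where f: "bij_betw f (Basis::'f set) B"
    using finite_same_card_bij[of Basis B] by auto
  have ipf: "ip (f i) (f j) = (if i = j then 1 else 0)" if "i \<in> Basis" "j \<in> Basis" for i j
    using on[of "f i" "f j"] f that by (auto simp: bij_betw_def inj_on_eq_iff)
  define A where "A v = (\<Sum>i\<in>Basis. (v \<bullet> i) *\<^sub>R f i)" for v
  have lin: "linear A"
    unfolding A_def
    by (auto intro!: linearI simp: inner_add_left scaleR_add_left sum.distrib scaleR_sum_right)
  have linl: "linear (\<lambda>v. ip v w)" and linr: "linear (ip w)" for w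
    using bil by (auto simp: bilinear_def)
  have iso: "ip (A v) (A w) = v \<bullet> w" for v w
  proof -
    have "ip (A v) (A w) = (\<Sum>i\<in>Basis. (v \<bullet> i) * ip (f i) (A w))"
      unfolding A_def[of v] by (simp add: linear_sum[OF linl] linear_scale[OF linl])
    also have "\<dots> = (\<Sum>i\<in>Basis. \<Sum>j\<in>Basis. (v \<bullet> i) * ((w \<bullet> j) * ip (f i) (f j)))"
      unfolding A_def[of w]
      by (simp add: linear_sum[OF linr] linear_scale[OF linr] sum_distrib_left)
    also have "\<dots> = (\<Sum>i\<in>Basis. \<Sum>j\<in>Basis. if i = j then (v \<bullet> i) * (w \<bullet> j) else 0)"
      by (intro sum.cong refl) (simp add: ipf)
    also have "\<dots> = v \<bullet> w"
      by (simp add: euclidean_inner[of v w])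
    finally show ?thesis .
  qed
  have "v = 0" if "A v = 0" for v
    using iso[of v v] that bilinear_lzero[OF bil] by simp
  then have "inj A" using lin by (simp add: linear_injective_0)
  then have "bij A"
    using lin linear_injective_imp_surjective by (auto simp: bij_def)
  show thesis by (rule that[OF lin \<open>bij A\<close> iso])
qed

lemma proj_in_base:
  assumes "riemannian_vector_bundle E" "\<xi> \<in> points (total E)"
  shows "proj E \<xi> \<in> points (base E)"
  using assms continuous_map_image_subset_topspace[of "mtop (total E)" "mtop (base E)" "proj E"]
  unfolding riemannian_vector_bundle_def smooth_vector_bundle_def smooth_map_def by blast

lemma fibre_closed:
  assumes E: "riemannian_vector_bundle E" and x: "x \<in> points (base E)"
  shows vzero_in_fibre: "vzero E x \<in> fibre E x"
    and vadd_in_fibre: "\<xi> \<in> fibre E x \<Longrightarrow> \<eta> \<in> fibre E x \<Longrightarrow> vadd E \<xi> \<eta> \<in> fibre E x"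
    and vscale_in_fibre: "\<xi> \<in> fibre E x \<Longrightarrow> vscale E a \<xi> \<in> fibre E x"
    and vadd_vzero_vzero: "vadd E (vzero E x) (vzero E x) = vzero E x"
proof -
  have vs: "real_vector_space_on (fibre E x) (vadd E) (vscale E) (vzero E x)"
    using E x unfolding riemannian_vector_bundle_def smooth_vector_bundle_def by blast
  note vs = vs[unfolded real_vector_space_on_def]
  show "vzero E x \<in> fibre E x"
    "\<xi> \<in> fibre E x \<Longrightarrow> \<eta> \<in> fibre E x \<Longrightarrow> vadd E \<xi> \<eta> \<in> fibre E x"
    "\<xi> \<in> fibre E x \<Longrightarrow> vscale E a \<xi> \<in> fibre E x"
    "vadd E (vzero E x) (vzero E x) = vzero E x"
    using conjunct1[OF vs] vs[THEN conjunct2, THEN conjunct1]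
      vs[THEN conjunct2, THEN conjunct2, THEN conjunct1]
      vs[THEN conjunct2, THEN conjunct2, THEN conjunct2, THEN conjunct2, THEN conjunct2, THEN conjunct1]
    by blast+
qed

text \<open>Without an isometry the defining condition of the vertical mean curvature would hold
  vacuously for every number.\<close>

lemma fibre_isometry_exists:
  fixes E :: "('p, 'b::euclidean_space, 'e, 'f::euclidean_space) vbundle"
  assumes E: "riemannian_vector_bundle E" and x: "x \<in> points (base E)"
  shows "\<exists>L. fibre_isometry E x L"
proof -
  let ?V = "fibre E x"
  obtain U \<Phi> where "x \<in> U" "local_trivialization E U \<Phi>"
    using E x unfolding riemannian_vector_bundle_def smooth_vector_bundle_def by blast
  then have bij: "bij_betw \<Phi> ?V UNIV"
    and \<Phi>_add: "\<And>\<xi> \<eta>. \<xi> \<in> ?V \<Longrightarrow> \<eta> \<in> ?V \<Longrightarrow> \<Phi> (vadd E \<xi> \<eta>) = \<Phi> \<xi> + \<Phi> \<eta>"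
    and \<Phi>_scale: "\<And>a \<xi>. \<xi> \<in> ?V \<Longrightarrow> \<Phi> (vscale E a \<xi>) = a *\<^sub>R \<Phi> \<xi>"
    unfolding local_trivialization_def by blast+
  note cl = fibre_closed[OF E x]
  have sym: "\<And>\<xi> \<eta>. \<xi> \<in> ?V \<Longrightarrow> \<eta> \<in> ?V \<Longrightarrow> vmetric E \<xi> \<eta> = vmetric E \<eta> \<xi>"
    and m_add: "\<And>\<xi> \<eta> \<zeta>. \<xi> \<in> ?V \<Longrightarrow> \<eta> \<in> ?V \<Longrightarrow> \<zeta> \<in> ?V \<Longrightarrow>
      vmetric E (vadd E \<xi> \<eta>) \<zeta> = vmetric E \<xi> \<zeta> + vmetric E \<eta> \<zeta>"
    and m_scale: "\<And>a \<xi> \<eta>. \<xi> \<in> ?V \<Longrightarrow> \<eta> \<in> ?V \<Longrightarrow>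
      vmetric E (vscale E a \<xi>) \<eta> = a * vmetric E \<xi> \<eta>"
    and m_pos: "\<And>\<xi>. \<xi> \<in> ?V \<Longrightarrow> \<xi> \<noteq> vzero E x \<Longrightarrow> vmetric E \<xi> \<xi> > 0"
    using E x unfolding riemannian_vector_bundle_def by blast+
  define J where "J = inv_into ?V \<Phi>"
  have J: "J v \<in> ?V" "\<Phi> (J v) = v" for v
    using bij unfolding J_def bij_betw_def by (metis UNIV_I inv_into_into, metis UNIV_I f_inv_into_f)
  have inj: "\<Phi> \<xi> = \<Phi> \<eta> \<Longrightarrow> \<xi> = \<eta>" if "\<xi> \<in> ?V" "\<eta> \<in> ?V" for \<xi> \<eta>
    using bij that unfolding bij_betw_def inj_on_def by blast
  have J_add: "J (v + w) = vadd E (J v) (J w)" for v w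
    by (rule inj) (simp_all add: J cl \<Phi>_add)
  have J_scale: "J (a *\<^sub>R v) = vscale E a (J v)" for a v
    by (rule inj) (simp_all add: J cl \<Phi>_scale)
  have J_nz: "J v \<noteq> vzero E x" if "v \<noteq> 0" for v
    using \<Phi>_add[OF cl(1) cl(1)] cl(4) J(2)[of v] that by auto
  \<comment> \<open>The fibre metric transported to the model space by the trivialization.\<close>
  define ip where "ip v w = vmetric E (J v) (J w)" for v w
  have ip_sym: "ip v w = ip w v" for v w
    unfolding ip_def using sym J(1) by blast
  have ip_lin: "linear (\<lambda>v. ip v w)" for w
    by (rule linearI) (simp_all only: ip_def J_add J_scale m_add m_scale J real_scaleR_def)
  have flip: "ip w = (\<lambda>v. ip v w)" for w
    by (rule ext) (rule ip_sym)
  have "linear (ip w)" for w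
    by (subst flip) (rule ip_lin)
  then have "bilinear ip"
    using ip_lin by (auto simp: bilinear_def)
  moreover have "ip v v > 0" if "v \<noteq> 0" for v
    unfolding ip_def using m_pos J(1) J_nz[OF that] by blast
  ultimately obtain A :: "'f \<Rightarrow> 'f" where A: "linear A" "bij A" "\<And>v w. ip (A v) (A w) = v \<bullet> w"
    using isometry_to_inner_product[of ip] ip_sym by blast
  have "bij_betw J UNIV ?V"
    unfolding J_def by (rule bij_betw_inv_into[OF bij])
  then have "bij_betw (J \<circ> A) UNIV ?V"
    using A(2) bij_betw_trans by blast
  then have "fibre_isometry E x (J \<circ> A)"
    using A unfolding fibre_isometry_def
    by (auto simp: linear_add linear_scale J_add J_scale ip_def)
  then show ?thesis by blast
qed

section \<open>The logarithm of a smooth function on a manifold\<close>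

lemma chart_open_image:
  assumes "is_chart T c" "openin T W"
  shows "open (snd c ` (fst c \<inter> W))"
proof -
  have h: "homeomorphic_map (subtopology T (fst c)) (top_of_set (snd c ` fst c)) (snd c)"
    and o: "open (snd c ` fst c)"
    using assms(1) by (auto simp: is_chart_def)
  have "openin (subtopology T (fst c)) (fst c \<inter> W)"
    using assms(2) by (auto simp: openin_subtopology)
  then have "openin (top_of_set (snd c ` fst c)) (snd c ` (fst c \<inter> W))"
    using h homeomorphic_imp_open_map open_map_def by metis
  then show ?thesis using o openin_open_trans by blast
qed

lemma chart_inv_chart:
  assumes "is_chart T c" "q \<in> fst c"
  shows "chart_inv c (snd c q) = q"
proof -
  have "topspace (subtopology T (fst c)) = fst c"
    using assms(1) openin_subset by (fastforce simp: is_chart_def)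
  then have "inj_on (snd c) (fst c)"
    using assms(1) homeomorphic_imp_injective_map unfolding is_chart_def by metis
  then show ?thesis using assms(2) by (simp add: chart_inv_def)
qed

lemma C_inf_subset:
  assumes "f \<in> C_inf M S" "T \<subseteq> S"
  shows "f \<in> C_inf M T"
proof -
  have sub: "S \<subseteq> points M"
    and ext: "\<forall>p\<in>S. \<exists>W h. p \<in> W \<and> smooth_on_open M W h \<and> (\<forall>q\<in>S \<inter> W. f q = h q)"
    using assms(1) unfolding C_inf_def by simp_all
  have "\<exists>W h. p \<in> W \<and> smooth_on_open M W h \<and> (\<forall>q\<in>T \<inter> W. f q = h q)" if "p \<in> T" for p
    using bspec[OF ext subsetD[OF assms(2) that]] assms(2) by (elim exE conjE) (intro exI conjI, auto)
  moreover have "T \<subseteq> points M" using assms(2) sub by (rule subset_trans)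
  ultimately show ?thesis unfolding C_inf_def by simp
qed

text \<open>A local smooth extension of a positive function need not be positive, but it is positive on
  a neighbourhood of each point of \<open>S\<close>, and there its logarithm is smooth.\<close>

lemma C_inf_ln_divide:
  assumes M: "smooth_manifold M" and f: "f \<in> C_inf M S"
    and pos: "\<And>p. p \<in> S \<Longrightarrow> f p > 0" and a: "a > 0"
  shows "(\<lambda>p. ln (a / f p)) \<in> C_inf M S"
proof -
  have chart: "is_chart (mtop M) c" if "c \<in> atlas M" for c
    using M that unfolding smooth_manifold_def by blast
  have "\<exists>W h. p \<in> W \<and> smooth_on_open M W h \<and> (\<forall>q\<in>S \<inter> W. ln (a / f q) = h q)"
    if p: "p \<in> S" for p
  proof -
    obtain W h where W: "p \<in> W" and h: "smooth_on_open M W h" and fh: "\<And>q. q \<in> S \<inter> W \<Longrightarrow> f q = h q"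
      using f p unfolding C_inf_def by blast
    have oW: "openin (mtop M) W" using h by (simp add: smooth_on_open_def)
    have sm: "smooth_on (h \<circ> chart_inv c) (snd c ` (fst c \<inter> W))" if "c \<in> atlas M" for c
      using h that unfolding smooth_on_open_def by blast
    define W' where "W' = {q \<in> W. h q > 0}"
    have part: "openin (mtop M) (fst c \<inter> W')" if c: "c \<in> atlas M" for c
    proof -
      let ?T = "snd c ` (fst c \<inter> W)" and ?h = "h \<circ> chart_inv c"
      have "Ck_on 0 ?h ?T" using sm[OF c] unfolding smooth_on_def by blast
      then have "open (?T \<inter> ?h -` {0<..})"
        using chart_open_image[OF chart[OF c] oW]
        by (intro continuous_open_preimage) auto
      moreover have "continuous_map (subtopology (mtop M) (fst c)) euclidean (snd c)"
        using chart[OF c] homeomorphic_imp_continuous_map continuous_map_into_fulltopology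
        unfolding is_chart_def by blast
      ultimately have "openin (subtopology (mtop M) (fst c))
          {q \<in> topspace (subtopology (mtop M) (fst c)). snd c q \<in> ?T \<inter> ?h -` {0<..}}"
        by (intro openin_continuous_map_preimage) auto
      moreover have "openin (mtop M) (fst c)" using chart[OF c] by (simp add: is_chart_def)
      ultimately have "openin (mtop M)
          {q \<in> topspace (subtopology (mtop M) (fst c)). snd c q \<in> ?T \<inter> ?h -` {0<..}}"
        using openin_trans_full by blast
      moreover have "{q \<in> topspace (subtopology (mtop M) (fst c)). snd c q \<in> ?T \<inter> ?h -` {0<..}}
          = fst c \<inter> W'"
      proof -
        have "snd c q \<in> ?T \<longleftrightarrow> q \<in> W" if "q \<in> fst c" for q
        proof -
          have "q = q'" if "q' \<in> fst c" "snd c q = snd c q'" for q'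
            by (rule trans[OF chart_inv_chart[OF chart[OF c] \<open>q \<in> fst c\<close>, symmetric]])
              (simp only: that(2) chart_inv_chart[OF chart[OF c] that(1)])
          then show ?thesis using that by blast
        qed
        moreover have "fst c \<subseteq> points M"
          using \<open>openin (mtop M) (fst c)\<close> openin_subset by blast
        moreover have "?h (snd c q) = h q" if "q \<in> fst c" for q
          using chart_inv_chart[OF chart[OF c] that] by simp
        ultimately have "q \<in> points M \<and> q \<in> fst c \<and> snd c q \<in> ?T \<and> 0 < ?h (snd c q) \<longleftrightarrow>
            q \<in> fst c \<and> q \<in> W \<and> 0 < h q" for q
          by (cases "q \<in> fst c") auto
        then show ?thesis
          unfolding W'_def set_eq_iff topspace_subtopology Int_iff vimage_eq greaterThan_iff
            mem_Collect_eq by simp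
      qed
      ultimately show ?thesis by simp
    qed
    have "W' = (\<Union>c\<in>atlas M. fst c \<inter> W')"
    proof -
      have "(\<Union>c\<in>atlas M. fst c) = points M" using M by (simp add: smooth_manifold_def)
      moreover have "W' \<subseteq> points M" using openin_subset[OF oW] by (auto simp: W'_def)
      ultimately have "W' \<subseteq> (\<Union>c\<in>atlas M. fst c)" by simp
      then show ?thesis by blast
    qed
    moreover have "openin (mtop M) (\<Union>c\<in>atlas M. fst c \<inter> W')"
      using part by (intro openin_Union) auto
    ultimately have oW': "openin (mtop M) W'" by simp
    have "smooth_on ((\<lambda>q. ln (a / h q)) \<circ> chart_inv c) (snd c ` (fst c \<inter> W'))"
      if c: "c \<in> atlas M" for c
      unfolding smooth_on_def
    proof
      fix k
      let ?T = "snd c ` (fst c \<inter> W')" and ?h = "h \<circ> chart_inv c"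
      have o: "open ?T" by (rule chart_open_image[OF chart[OF c] oW'])
      have hk: "Ck_on k ?h ?T"
        using sm[OF c] Ck_on_subset[of k ?h "snd c ` (fst c \<inter> W)" ?T]
        unfolding smooth_on_def W'_def by blast
      have hp: "?h y > 0" if "y \<in> ?T" for y
        using that chart_inv_chart[OF chart[OF c]] by (auto simp: W'_def)
      have "Ck_on k (\<lambda>y. a * inverse (?h y)) ?T"
        by (rule Ck_on_mult[OF o Ck_on_const
            Ck_on_inverse[OF o less_imp_neq[OF hp, THEN not_sym] hk]])
      moreover have "0 < a * inverse (?h y)" if "y \<in> ?T" for y
        by (rule mult_pos_pos[OF a positive_imp_inverse_positive[OF hp[OF that]]])
      ultimately have "Ck_on k (\<lambda>y. ln (a * inverse (?h y))) ?T"
        by (intro Ck_on_ln o)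
      then show "Ck_on k ((\<lambda>q. ln (a / h q)) \<circ> chart_inv c) ?T"
        by (simp add: o_def divide_inverse)
    qed
    then have "smooth_on_open M W' (\<lambda>q. ln (a / h q))"
      using oW' by (simp add: smooth_on_open_def)
    moreover have "p \<in> W'" using p W pos[OF p] fh[of p] by (simp add: W'_def)
    moreover have "\<forall>q\<in>S \<inter> W'. ln (a / f q) = ln (a / h q)" using fh by (auto simp: W'_def)
    ultimately show ?thesis by (intro exI conjI)
  qed
  then show ?thesis using f unfolding C_inf_def by simp
qed

section \<open>Spheres of varying radius in the fibres\<close>

text \<open>The zero vector has norm zero because the fibre metric is additive and zero is its own
  double.\<close>

lemma punctured_if_vnorm_nonzero:
  assumes E: "riemannian_vector_bundle E" and \<xi>: "\<xi> \<in> points (total E)" "vnorm E \<xi> \<noteq> 0"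
  shows "\<xi> \<in> punctured E"
proof -
  let ?x = "proj E \<xi>"
  have x: "?x \<in> points (base E)" by (rule proj_in_base[OF E \<xi>(1)])
  have "vzero E ?x \<in> fibre E ?x" "vadd E (vzero E ?x) (vzero E ?x) = vzero E ?x"
    using fibre_closed[OF E x] by auto
  then have "vmetric E (vzero E ?x) (vzero E ?x) =
      vmetric E (vzero E ?x) (vzero E ?x) + vmetric E (vzero E ?x) (vzero E ?x)"
    using E x unfolding riemannian_vector_bundle_def by metis
  then have "vnorm E (vzero E ?x) = 0" by (simp add: vnorm_def)
  then show ?thesis using \<xi> by (auto simp: punctured_def)
qed

lemma radial_graph_fibre:
  fixes E :: "('p, 'b::euclidean_space, 'e, 'f::euclidean_space) vbundle"
  assumes E: "riemannian_vector_bundle E" and x: "x \<in> points (base E)"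
    and L: "fibre_isometry E x L" and r: "r > 0"
    and u: "\<And>\<xi>. \<xi> \<in> sphere_bundle E \<Longrightarrow> proj E \<xi> = x \<Longrightarrow> exp (u \<xi>) = r"
  shows "L -` (radial_graph E u \<inter> fibre E x) = sphere 0 r"
proof -
  have L_in: "L q \<in> fibre E x" for q
    using L unfolding fibre_isometry_def bij_betw_def by blast
  have L_norm: "vnorm E (L q) = norm q" for q
    using L by (simp add: fibre_isometry_def vnorm_def norm_eq_sqrt_inner)
  have L_scale: "L (a *\<^sub>R q) = vscale E a (L q)" for a q
    using L unfolding fibre_isometry_def by blast
  have L_inj: "L q = L q' \<Longrightarrow> q = q'" for q q'
    using L unfolding fibre_isometry_def bij_betw_def inj_def by blast
  have L_surj: "\<exists>q. \<xi> = L q" if "\<xi> \<in> fibre E x" for \<xi>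
    using L that unfolding fibre_isometry_def bij_betw_def by blast
  have scale_proj: "proj E (vscale E a \<xi>) = proj E \<xi>" if "\<xi> \<in> sphere_bundle E" for a \<xi>
  proof -
    have "\<xi> \<in> fibre E (proj E \<xi>)" "proj E \<xi> \<in> points (base E)"
      using that proj_in_base[OF E] by (auto simp: fibre_def sphere_bundle_def)
    then have "vscale E a \<xi> \<in> fibre E (proj E \<xi>)"
      using vscale_in_fibre[OF E] by blast
    then show ?thesis by (simp add: fibre_def)
  qed
  show ?thesis
  proof (intro set_eqI iffI)
    fix q assume "q \<in> L -` (radial_graph E u \<inter> fibre E x)"
    then obtain \<xi> where \<xi>: "\<xi> \<in> sphere_bundle E" "L q = vscale E (exp (u \<xi>)) \<xi>"
      by (auto simp: radial_graph_def)
    have px: "proj E \<xi> = x"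
      using scale_proj[OF \<xi>(1)] \<xi>(2) L_in[of q] by (simp add: fibre_def)
    then obtain w where w: "\<xi> = L w"
      using L_surj \<xi>(1) by (auto simp: fibre_def sphere_bundle_def)
    have "L q = L (r *\<^sub>R w)" using \<xi> u px w L_scale by simp
    then have "q = r *\<^sub>R w" by (rule L_inj)
    moreover have "norm w = 1" using \<xi>(1) w L_norm by (simp add: sphere_bundle_def)
    ultimately show "q \<in> sphere 0 r" using r by simp
  next
    fix q :: 'f assume "q \<in> sphere 0 r"
    then have "norm (q /\<^sub>R r) = 1" using r by simp
    then have \<xi>: "L (q /\<^sub>R r) \<in> sphere_bundle E" "proj E (L (q /\<^sub>R r)) = x"
      using L_norm L_in by (auto simp: sphere_bundle_def fibre_def)
    have "L q = L (r *\<^sub>R (q /\<^sub>R r))" using r by simp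
    also have "\<dots> = vscale E (exp (u (L (q /\<^sub>R r)))) (L (q /\<^sub>R r))"
      unfolding L_scale[of r] u[OF \<xi>] ..
    finally have "L q \<in> radial_graph E u"
      unfolding radial_graph_def using \<xi>(1) by (rule image_eqI)
    then show "q \<in> L -` (radial_graph E u \<inter> fibre E x)"
      using L_in by simp
  qed
qed

theorem mainTheorem1:
  fixes E :: "('p, 'b::euclidean_space, 'e, 'f::euclidean_space) vbundle"
    and g :: "('p, 'b) chart \<Rightarrow> 'p \<Rightarrow> 'b \<Rightarrow> 'b \<Rightarrow> real"
    and K :: "'e \<Rightarrow> real" and k :: "'p \<Rightarrow> real"
  assumes "riemannian_manifold (base E) g"
    and "compact_space (mtop (base E))"
    and "riemannian_vector_bundle E"
    and "DIM('f) \<ge> 2"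
    and "K \<in> C_inf (total E) (punctured E)"
    and "\<And>\<xi>. \<xi> \<in> punctured E \<Longrightarrow> K \<xi> > 0"
    and "k \<in> C_inf (base E) (points (base E))"
    and "\<And>x. x \<in> points (base E) \<Longrightarrow> k x > 0"
    and "\<And>\<xi>. \<xi> \<in> punctured E \<Longrightarrow> K \<xi> = k (proj E \<xi>)"
  shows "\<exists>u \<in> C_inf (total E) (sphere_bundle E).
           \<forall>\<eta> \<in> radial_graph E u.
             vertical_mean_curvature E (radial_graph E u) \<eta> = K \<eta>"
proof -
  note E = assms(3)
  define m where "m = real DIM('f) - 1"
  have m: "m > 0" using assms(4) by (simp add: m_def)
  define u where "u \<xi> = ln (m / K \<xi>)" for \<xi>
  have sub: "sphere_bundle E \<subseteq> punctured E"
    using punctured_if_vnorm_nonzero[OF E] by (auto simp: sphere_bundle_def)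
  have "smooth_manifold (total E)"
    using E by (simp add: riemannian_vector_bundle_def smooth_vector_bundle_def)
  then have "u \<in> C_inf (total E) (sphere_bundle E)"
    unfolding u_def using assms(6) sub
    by (intro C_inf_ln_divide C_inf_subset[OF assms(5) sub] m) auto
  moreover have "vertical_mean_curvature E (radial_graph E u) \<eta> = K \<eta>"
    if \<eta>: "\<eta> \<in> radial_graph E u" for \<eta>
  proof -
    let ?x = "proj E \<eta>"
    obtain \<xi> where \<xi>: "\<xi> \<in> sphere_bundle E" "\<eta> = vscale E (exp (u \<xi>)) \<xi>"
      using \<eta> by (auto simp: radial_graph_def)
    have "\<xi> \<in> fibre E (proj E \<xi>)" "proj E \<xi> \<in> points (base E)"
      using \<xi>(1) proj_in_base[OF E] by (auto simp: fibre_def sphere_bundle_def)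
    then have "\<eta> \<in> fibre E (proj E \<xi>)"
      using vscale_in_fibre[OF E] \<xi>(2) by blast
    then have \<eta>_pt: "\<eta> \<in> points (total E)" and \<eta>_fib: "\<eta> \<in> fibre E ?x"
      by (auto simp: fibre_def)
    have x: "?x \<in> points (base E)" by (rule proj_in_base[OF E \<eta>_pt])
    define r where "r = m / k ?x"
    have kx: "k ?x > 0" by (rule assms(8)[OF x])
    have r: "r > 0" using m kx by (simp add: r_def)
    have u: "exp (u \<xi>) = r" if "\<xi> \<in> sphere_bundle E" "proj E \<xi> = ?x" for \<xi>
      using that sub assms(9)[of \<xi>] m kx by (auto simp: u_def r_def)
    \<comment> \<open>The equivalence gives existence and uniqueness of the described number together.\<close>
    have iff: "has_mean_curvature (L -` (radial_graph E u \<inter> fibre E ?x)) (inv L \<eta>) H \<longleftrightarrow>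
        H = k ?x" and \<eta>_norm: "vnorm E \<eta> = r" if L: "fibre_isometry E ?x L" for L H
    proof -
      have S: "L -` (radial_graph E u \<inter> fibre E ?x) = sphere 0 r"
        by (rule radial_graph_fibre[OF E x L r u])
      have "L (inv L \<eta>) = \<eta>"
        using L \<eta>_fib unfolding fibre_isometry_def bij_betw_def by (metis f_inv_into_f)
      then have n: "norm (inv L \<eta>) = r"
        using \<eta> \<eta>_fib S by (metis IntI mem_sphere_0 vimageI2)
      show "has_mean_curvature (L -` (radial_graph E u \<inter> fibre E ?x)) (inv L \<eta>) H \<longleftrightarrow> H = k ?x"
        unfolding S has_mean_curvature_sphere[OF r n] using m kx by (simp add: r_def m_def)
      have "vmetric E (L (inv L \<eta>)) (L (inv L \<eta>)) = inv L \<eta> \<bullet> inv L \<eta>"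
        using L unfolding fibre_isometry_def by blast
      then show "vnorm E \<eta> = r"
        using n \<open>L (inv L \<eta>) = \<eta>\<close> by (simp add: vnorm_def norm_eq_sqrt_inner)
    qed
    obtain L where L: "fibre_isometry E ?x L" using fibre_isometry_exists[OF E x] by blast
    have "vertical_mean_curvature E (radial_graph E u) \<eta> = k ?x"
      unfolding vertical_mean_curvature_def using iff L by (intro the_equality) blast+
    also have "\<dots> = K \<eta>"
    proof -
      have "\<eta> \<in> punctured E"
        using punctured_if_vnorm_nonzero[OF E \<eta>_pt] \<eta>_norm[OF L] r by simp
      then show ?thesis using assms(9) by simp
    qed
    finally show ?thesis .
  qed
  ultimately show ?thesis by blast
qed

end
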